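(* Let $p\ge q\ge 1$ be integers and let $U_1=\|\mathbf Y\|_2^2-pq$. For any $p\times q$ real matrix $\mathbf A$, with $\mathbf Y=\mathbf A+\mathbf E$, $$\mathbb E\big[\,|U_1-\|\mathbf A\|_2^2|\,\big]\le \sqrt{2pq}+2\|\mathbf A\|_2 ,$$ $$\mathbb E\big[\,|(U_1)_+^{1/2}-\|\mathbf A\|_2|\,\big]\le 3(pq)^{1/4}.$$
   Context: $\mathbf A$ is a deterministic real $p\times q$ matrix and $\mathbf E$ is a $p\times q$ random matrix with independent standard normal entries; one observes $\mathbf Y=\mathbf A+\mathbf E$. For a matrix $\mathbf B$, $\|\mathbf B\|_2=(\sum_{i,j}\mathbf B_{ij}^2)^{1/2}$ is the Frobenius norm (2-Schatten norm). $x_+=\max(x,0)$. *)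

theory Defs
  imports "HOL-Probability.Probability"
begin
(* A p x q matrix is a vector of rows: real ^ (columns) ^ (rows). On this type the library
   norm is also the Frobenius norm, and A + B is entrywise addition. *)

definition frobenius_norm :: "real ^ 'q ^ 'p \<Rightarrow> real" where
  "frobenius_norm B = sqrt (\<Sum>i\<in>UNIV. \<Sum>j\<in>UNIV. (B $ i $ j)\<^sup>2)"

definition std_gaussian_matrix :: "'w measure \<Rightarrow> ('w \<Rightarrow> real ^ 'q ^ 'p) \<Rightarrow> bool" where
  "std_gaussian_matrix M E \<longleftrightarrow>
     prob_space.indep_vars M (\<lambda>_. borel) (\<lambda>(i, j) \<omega>. E \<omega> $ i $ j) (UNIV :: ('p \<times> 'q) set) \<and>
     (\<forall>i j. distributed M lborel (\<lambda>\<omega>. E \<omega> $ i $ j) (\<lambda>x. ennreal (std_normal_density x)))"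

definition U1 :: "real ^ 'q ^ 'p \<Rightarrow> real" where
  "U1 Y = (frobenius_norm Y)\<^sup>2 - real CARD('p) * real CARD('q)"

end

theory Submission imports Defs begin

text \<open>
  Write \<open>a\<close> for the norm of \<open>A\<close>, \<open>N\<close> for the number \<open>p q\<close> of entries and \<open>z\<^sub>i\<^sub>j\<close> for the
  entries of the noise \<open>E\<close>. Expanding the square gives
  \<open>U1 Y - a\<^sup>2 = (\<Sum>i j. z\<^sub>i\<^sub>j\<^sup>2 - 1) + 2 * (\<Sum>i j. A\<^sub>i\<^sub>j * z\<^sub>i\<^sub>j)\<close>. Both sums have independent centred
  summands, so their second moments add up (\<open>second_moment_sum_indep_centred\<close>): to \<open>2 N\<close> for the
  first one, because \<open>z\<^sup>2\<close> has variance \<open>2\<close> for a standard normal \<open>z\<close>, and to \<open>a\<^sup>2\<close> for the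
  second one. As the first absolute moment is at most the root of the second moment, the bound
  \<open>sqrt (2 N) + 2 a\<close> follows.

  For the square root, put \<open>s = sqrt (max (U1 Y) 0)\<close> and \<open>D = \<bar>U1 Y - a\<^sup>2\<bar>\<close>. From
  \<open>\<bar>s - a\<bar> * (s + a) \<le> D\<close> there are two pointwise estimates: \<open>\<bar>s - a\<bar> * a \<le> D\<close>, useful for
  large \<open>a\<close>, and \<open>\<bar>s - a\<bar>\<^sup>2 \<le> D\<close>, useful for small \<open>a\<close>. If \<open>a \<ge> 2 * N powr (1/4)\<close>, the first
  bounds the expectation by \<open>sqrt (2 N) / a + 2\<close>; otherwise the second, made linear in \<open>D\<close> by the
  inequality of arithmetic and geometric means, gives a bound of order
  \<open>N powr (1/4)\<close>. Either way the result is at most \<open>3 * N powr (1/4)\<close>, using \<open>N \<ge> 1\<close>.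
\<close>

lemma (in prob_space) expectation_abs_le_sqrt_second_moment:
  fixes X :: "'a \<Rightarrow> real"
  assumes [measurable]: "random_variable borel X"
    and sq: "integrable M (\<lambda>\<omega>. (X \<omega>)\<^sup>2)"
  shows "expectation (\<lambda>\<omega>. \<bar>X \<omega>\<bar>) \<le> sqrt (expectation (\<lambda>\<omega>. (X \<omega>)\<^sup>2))"
proof (rule real_le_rsqrt)
  have "integrable M X"
    using square_integrable_imp_integrable[OF _ sq] by simp
  then have "variance (\<lambda>\<omega>. \<bar>X \<omega>\<bar>) = expectation (\<lambda>\<omega>. (X \<omega>)\<^sup>2) - (expectation (\<lambda>\<omega>. \<bar>X \<omega>\<bar>))\<^sup>2"
    using sq by (subst variance_eq) auto
  then show "(expectation (\<lambda>\<omega>. \<bar>X \<omega>\<bar>))\<^sup>2 \<le> expectation (\<lambda>\<omega>. (X \<omega>)\<^sup>2)"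
    using variance_positive[of "\<lambda>\<omega>. \<bar>X \<omega>\<bar>"] by simp
qed

text \<open>
  The mixed terms of the squared sum vanish: a summand is independent of the sum of the others, and
  both are centred. Square integrability of the sum is part of the conclusion because the induction
  and the applications need it.
\<close>

lemma (in prob_space) second_moment_sum_indep_centred:
  fixes X :: "'i \<Rightarrow> 'a \<Rightarrow> real"
  assumes "finite I" and "indep_vars (\<lambda>_. borel) X I"
    and "\<And>i. i \<in> I \<Longrightarrow> integrable M (\<lambda>\<omega>. (X i \<omega>)\<^sup>2)"
    and "\<And>i. i \<in> I \<Longrightarrow> expectation (X i) = 0"
  shows "integrable M (\<lambda>\<omega>. (\<Sum>i\<in>I. X i \<omega>)\<^sup>2)
    \<and> expectation (\<lambda>\<omega>. (\<Sum>i\<in>I. X i \<omega>)\<^sup>2) = (\<Sum>i\<in>I. expectation (\<lambda>\<omega>. (X i \<omega>)\<^sup>2))"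
  using assms
proof (induction I rule: finite_induct)
  case empty
  then show ?case by simp
next
  case (insert i I)
  let ?S = "\<lambda>\<omega>. \<Sum>i\<in>I. X i \<omega>"
  have rv [measurable]: "random_variable borel (X j)" if "j \<in> insert i I" for j
    using insert.prems(1) that unfolding indep_vars_def by blast
  have int: "integrable M (X j)" if "j \<in> insert i I" for j
    using square_integrable_imp_integrable[OF rv insert.prems(2)] that by blast
  have IH: "integrable M (\<lambda>\<omega>. (?S \<omega>)\<^sup>2)"
      "expectation (\<lambda>\<omega>. (?S \<omega>)\<^sup>2) = (\<Sum>i\<in>I. expectation (\<lambda>\<omega>. (X i \<omega>)\<^sup>2))"
    using insert.IH[OF indep_vars_subset[OF insert.prems(1)]] insert.prems by auto
  have intS: "integrable M ?S" using int by auto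
  have indep: "indep_var borel (X i) borel ?S"
    using indep_vars_sum[OF insert.hyps insert.prems(1)] .
  have mixed: "integrable M (\<lambda>\<omega>. X i \<omega> * ?S \<omega>)"
    using indep_var_integrable[OF indep _ intS] int by simp
  have mixed0: "expectation (\<lambda>\<omega>. X i \<omega> * ?S \<omega>) = 0"
    using indep_var_lebesgue_integral[OF indep _ intS] int insert.prems(3) by simp
  have expand: "(\<Sum>j\<in>insert i I. X j \<omega>)\<^sup>2 = (X i \<omega>)\<^sup>2 + (?S \<omega>)\<^sup>2 + 2 * (X i \<omega> * ?S \<omega>)" for \<omega>
    using insert.hyps by (simp add: power2_sum)
  show ?case
    unfolding expand using insert.hyps insert.prems IH mixed mixed0 by simp
qed

lemma (in prob_space) expectation_abs_sum_indep_centred_le: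
  fixes X :: "'i \<Rightarrow> 'a \<Rightarrow> real"
  assumes "finite I" and "indep_vars (\<lambda>_. borel) X I"
    and "\<And>i. i \<in> I \<Longrightarrow> integrable M (\<lambda>\<omega>. (X i \<omega>)\<^sup>2)"
    and "\<And>i. i \<in> I \<Longrightarrow> expectation (X i) = 0"
  shows "integrable M (\<lambda>\<omega>. \<Sum>i\<in>I. X i \<omega>)"
    and "expectation (\<lambda>\<omega>. \<bar>\<Sum>i\<in>I. X i \<omega>\<bar>) \<le> sqrt (\<Sum>i\<in>I. expectation (\<lambda>\<omega>. (X i \<omega>)\<^sup>2))"
proof -
  have meas: "random_variable borel (\<lambda>\<omega>. \<Sum>i\<in>I. X i \<omega>)"
    using assms(2) by (intro borel_measurable_sum) (simp add: indep_vars_def)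
  have moment: "integrable M (\<lambda>\<omega>. (\<Sum>i\<in>I. X i \<omega>)\<^sup>2)"
      "expectation (\<lambda>\<omega>. (\<Sum>i\<in>I. X i \<omega>)\<^sup>2) = (\<Sum>i\<in>I. expectation (\<lambda>\<omega>. (X i \<omega>)\<^sup>2))"
    using second_moment_sum_indep_centred[OF assms] by auto
  show "integrable M (\<lambda>\<omega>. \<Sum>i\<in>I. X i \<omega>)"
    using square_integrable_imp_integrable[OF meas moment(1)] .
  show "expectation (\<lambda>\<omega>. \<bar>\<Sum>i\<in>I. X i \<omega>\<bar>) \<le> sqrt (\<Sum>i\<in>I. expectation (\<lambda>\<omega>. (X i \<omega>)\<^sup>2))"
    using expectation_abs_le_sqrt_second_moment[OF meas moment(1)] moment(2) by simp
qed

lemma (in prob_space) standard_normal_moments: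
  assumes "distributed M lborel Z std_normal_density"
  shows "integrable M (\<lambda>\<omega>. Z \<omega> ^ k)"
    and "expectation (\<lambda>\<omega>. Z \<omega> ^ (2 * k)) = fact (2 * k) / (2 ^ k * fact k)"
  using distributed_integrable[OF assms, of "\<lambda>x. x ^ k"] integrable_std_normal_moment[of k]
    distributed_integral[OF assms, of "\<lambda>x. x ^ (2 * k)"] integral_std_normal_moment_even[of k]
  by auto

lemma (in prob_space) standard_normal_centred_square:
  assumes Z: "distributed M lborel Z std_normal_density"
  shows "integrable M (\<lambda>\<omega>. ((Z \<omega>)\<^sup>2 - 1)\<^sup>2)"
    and "expectation (\<lambda>\<omega>. (Z \<omega>)\<^sup>2 - 1) = 0"
    and "expectation (\<lambda>\<omega>. ((Z \<omega>)\<^sup>2 - 1)\<^sup>2) = 2"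
proof -
  have expand: "((Z \<omega>)\<^sup>2 - 1)\<^sup>2 = Z \<omega> ^ 4 - 2 * (Z \<omega>)\<^sup>2 + 1" for \<omega>
    by (simp add: power2_eq_square power4_eq_xxxx algebra_simps)
  have int: "integrable M (\<lambda>\<omega>. Z \<omega> ^ 4)" "integrable M (\<lambda>\<omega>. (Z \<omega>)\<^sup>2)"
    using standard_normal_moments(1)[OF Z] by auto
  have second: "expectation (\<lambda>\<omega>. (Z \<omega>)\<^sup>2) = 1"
    using standard_normal_moments(2)[OF Z, of 1] by simp
  have fourth: "expectation (\<lambda>\<omega>. Z \<omega> ^ 4) = 3"
    using standard_normal_moments(2)[OF Z, of 2] by (simp add: fact_numeral)
  show "integrable M (\<lambda>\<omega>. ((Z \<omega>)\<^sup>2 - 1)\<^sup>2)"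
    unfolding expand using int by simp
  show "expectation (\<lambda>\<omega>. (Z \<omega>)\<^sup>2 - 1) = 0"
    using int second by (simp add: prob_space)
  show "expectation (\<lambda>\<omega>. ((Z \<omega>)\<^sup>2 - 1)\<^sup>2) = 2"
    unfolding expand using int second fourth by (simp add: prob_space)
qed

text \<open>
  Replacing \<open>u\<close> by its positive part only brings it closer to \<open>a\<^sup>2\<close>, and
  \<open>s\<^sup>2 - a\<^sup>2 = (s - a) * (s + a)\<close>, where \<open>s + a\<close> dominates both \<open>a\<close> and \<open>\<bar>s - a\<bar>\<close>.
\<close>

lemma abs_sqrt_positive_part_diff:
  fixes u a :: real
  assumes "0 \<le> a"
  defines "s \<equiv> sqrt (max u 0)"
  shows "\<bar>s - a\<bar> * a \<le> \<bar>u - a\<^sup>2\<bar>" and "\<bar>s - a\<bar>\<^sup>2 \<le> \<bar>u - a\<^sup>2\<bar>"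
proof -
  have s: "0 \<le> s" "s\<^sup>2 = max u 0"
    by (simp_all add: s_def)
  have "\<bar>s - a\<bar> * (s + a) = \<bar>s\<^sup>2 - a\<^sup>2\<bar>"
    using s(1) assms(1) by (simp add: power2_eq_square square_diff_square_factored abs_mult mult.commute)
  also have "\<dots> \<le> \<bar>u - a\<^sup>2\<bar>"
    unfolding s(2) using zero_le_power2[of a] by (auto simp: max_def abs_if)
  finally have key: "\<bar>s - a\<bar> * (s + a) \<le> \<bar>u - a\<^sup>2\<bar>" .
  have "\<bar>s - a\<bar> * a \<le> \<bar>s - a\<bar> * (s + a)"
    using s(1) by (intro mult_left_mono) auto
  then show "\<bar>s - a\<bar> * a \<le> \<bar>u - a\<^sup>2\<bar>" using key by simp
  have "\<bar>s - a\<bar> * \<bar>s - a\<bar> \<le> \<bar>s - a\<bar> * (s + a)"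
    using s(1) assms(1) by (intro mult_left_mono) auto
  then show "\<bar>s - a\<bar>\<^sup>2 \<le> \<bar>u - a\<^sup>2\<bar>" using key by (simp add: power2_eq_square)
qed

text \<open>
  This is the passage from the bound for \<open>U\<close> to the bound for its square root, with \<open>r\<close> in the
  role of the fourth root of \<open>N\<close>. The first term of \<open>bound\<close> then majorizes \<open>sqrt (2 N)\<close>; the loss
  is harmless for the constant \<open>3\<close>.
\<close>

lemma (in prob_space) expectation_abs_sqrt_positive_part_diff_le:
  fixes U :: "'a \<Rightarrow> real"
  assumes meas [measurable]: "random_variable borel U"
    and int: "integrable M (\<lambda>\<omega>. \<bar>U \<omega> - a\<^sup>2\<bar>)"
    and bound: "expectation (\<lambda>\<omega>. \<bar>U \<omega> - a\<^sup>2\<bar>) \<le> 2 * r\<^sup>2 + 2 * a"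
    and a: "0 \<le> a" and r: "1 \<le> r"
  shows "integrable M (\<lambda>\<omega>. \<bar>sqrt (max (U \<omega>) 0) - a\<bar>)"
    and "expectation (\<lambda>\<omega>. \<bar>sqrt (max (U \<omega>) 0) - a\<bar>) \<le> 3 * r"
proof -
  let ?G = "\<lambda>\<omega>. \<bar>sqrt (max (U \<omega>) 0) - a\<bar>"
  let ?D = "\<lambda>\<omega>. \<bar>U \<omega> - a\<^sup>2\<bar>"
  \<comment> \<open>Since \<open>g\<^sup>2 \<le> d\<close>, this is \<open>2 * 3 r * g \<le> g\<^sup>2 + (3 r)\<^sup>2\<close>. The weight \<open>3 r\<close> has the order
    of the root of the expected \<open>d\<close>, which is at most \<open>6 r\<^sup>2\<close> when \<open>a \<le> 2 r\<close>.\<close>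
  have amgm: "?G \<omega> \<le> ?D \<omega> / (6 * r) + 3 * r / 2" for \<omega>
  proof -
    have "0 \<le> (?G \<omega> - 3 * r)\<^sup>2" by simp
    also have "\<dots> = (?G \<omega>)\<^sup>2 - 6 * r * ?G \<omega> + 9 * r\<^sup>2"
      by (simp only: power2_diff) (simp add: power_mult_distrib)
    finally have "6 * r * ?G \<omega> \<le> ?D \<omega> + 9 * r\<^sup>2"
      using abs_sqrt_positive_part_diff(2)[OF a, of "U \<omega>"] by simp
    then show ?thesis
      using r by (simp add: field_simps power2_eq_square)
  qed
  have intA: "integrable M (\<lambda>\<omega>. ?D \<omega> / (6 * r) + 3 * r / 2)"
    using int by simp
  show intG: "integrable M ?G"
    using r by (intro Bochner_Integration.integrable_bound[OF intA])
      (auto intro!: AE_I2 order_trans[OF amgm])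
  show "expectation ?G \<le> 3 * r"
  proof (cases "2 * r \<le> a")
    case True
    then have "0 < a" using r by simp
    have "expectation ?G * a = expectation (\<lambda>\<omega>. ?G \<omega> * a)" by simp
    also have "\<dots> \<le> expectation ?D"
      using intG int abs_sqrt_positive_part_diff(1)[OF a]
      by (intro integral_mono) auto
    also have "\<dots> \<le> r * (2 * r) + 2 * a"
      using bound by (simp add: power2_eq_square)
    also have "\<dots> \<le> r * a + 2 * r * a"
      using True r a by (intro add_mono mult_left_mono mult_right_mono) auto
    finally have "expectation ?G * a \<le> (3 * r) * a" by (simp only: ring_distribs)
    then show ?thesis using \<open>0 < a\<close> by simp
  next
    case False
    have "r \<le> r\<^sup>2" using r by (simp add: power2_eq_square)
    with False bound have D: "expectation ?D \<le> 6 * r\<^sup>2" by simp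
    have "expectation ?G \<le> expectation (\<lambda>\<omega>. ?D \<omega> / (6 * r) + 3 * r / 2)"
      using intG intA amgm by (intro integral_mono) auto
    also have "\<dots> = expectation ?D / (6 * r) + 3 * r / 2"
      using int by (simp add: prob_space)
    also have "\<dots> \<le> r + 3 * r / 2"
      using D r by (simp add: divide_le_eq power2_eq_square mult.assoc)
    finally show ?thesis using r by simp
  qed
qed

lemma frobenius_norm_sq:
  "(frobenius_norm B)\<^sup>2 = (\<Sum>(i, j)\<in>UNIV. (B $ i $ j)\<^sup>2)"
  unfolding frobenius_norm_def
  by (simp add: sum_nonneg sum.cartesian_product case_prod_unfold)

lemma U1_add_minus_frobenius_norm_sq:
  fixes A Z :: "real ^ 'q ^ 'p"
  shows "U1 (A + Z) - (frobenius_norm A)\<^sup>2 =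
    (\<Sum>(i, j)\<in>UNIV. (Z $ i $ j)\<^sup>2 - 1) + 2 * (\<Sum>(i, j)\<in>UNIV. A $ i $ j * Z $ i $ j)"
  unfolding U1_def frobenius_norm_sq
  by (simp add: power2_sum case_prod_unfold sum.distrib sum_subtractf sum_distrib_left
      algebra_simps)

theorem proposition2p1:
  fixes M :: "'w measure"
    and A :: "real ^ 'q ^ 'p"
    and E Y :: "'w \<Rightarrow> real ^ 'q ^ 'p"
  assumes "CARD('p) \<ge> CARD('q)" and "CARD('q) \<ge> 1"
    and "prob_space M"
    and "std_gaussian_matrix M E"
    and "\<And>\<omega>. Y \<omega> = A + E \<omega>"
  shows "integrable M (\<lambda>\<omega>. \<bar>U1 (Y \<omega>) - (frobenius_norm A)\<^sup>2\<bar>)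
       \<and> prob_space.expectation M (\<lambda>\<omega>. \<bar>U1 (Y \<omega>) - (frobenius_norm A)\<^sup>2\<bar>)
           \<le> sqrt (2 * real CARD('p) * real CARD('q)) + 2 * frobenius_norm A
       \<and> integrable M (\<lambda>\<omega>. \<bar>sqrt (max (U1 (Y \<omega>)) 0) - frobenius_norm A\<bar>)
       \<and> prob_space.expectation M (\<lambda>\<omega>. \<bar>sqrt (max (U1 (Y \<omega>)) 0) - frobenius_norm A\<bar>)
           \<le> 3 * (real CARD('p) * real CARD('q)) powr (1 / 4)"
proof -
  interpret prob_space M by fact
  define a where "a = frobenius_norm A"
  define N where "N = real CARD('p) * real CARD('q)"
  define r where "r = N powr (1 / 4)"
  define X where "X = (\<lambda>(i, j) \<omega>. E \<omega> $ i $ j)"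
  define c where "c = (\<lambda>(i, j). A $ i $ j)"
  define W where "W = (\<lambda>\<omega>. \<Sum>k\<in>UNIV. (X k \<omega>)\<^sup>2 - 1)"
  define L where "L = (\<lambda>\<omega>. \<Sum>k\<in>UNIV. c k * X k \<omega>)"
  have a: "0 \<le> a"
    by (simp add: a_def frobenius_norm_def sum_nonneg)
  have indep: "indep_vars (\<lambda>_. borel) X UNIV"
    and normal: "\<And>k. distributed M lborel (X k) std_normal_density"
    using assms(4) by (auto simp: std_gaussian_matrix_def X_def)
  have U: "U1 (Y \<omega>) - a\<^sup>2 = W \<omega> + 2 * L \<omega>" for \<omega>
    unfolding assms(5) a_def U1_add_minus_frobenius_norm_sq
    by (simp add: W_def L_def X_def c_def case_prod_unfold)

  have indepW: "indep_vars (\<lambda>_. borel) (\<lambda>k \<omega>. (X k \<omega>)\<^sup>2 - 1) UNIV"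
    by (rule indep_vars_compose2[OF indep]) simp
  note W = expectation_abs_sum_indep_centred_le[OF finite indepW
      standard_normal_centred_square(1,2)[OF normal]]
  have intW: "integrable M W" and absW: "expectation (\<lambda>\<omega>. \<bar>W \<omega>\<bar>) \<le> sqrt (2 * N)"
    using W by (simp_all add: W_def N_def standard_normal_centred_square(3)[OF normal]
        ac_simps flip: UNIV_Times_UNIV)

  have indepL: "indep_vars (\<lambda>_. borel) (\<lambda>k \<omega>. c k * X k \<omega>) UNIV"
    by (rule indep_vars_compose2[OF indep]) simp
  have "integrable M (\<lambda>\<omega>. (X k \<omega>)\<^sup>2)" "expectation (X k) = 0" "expectation (\<lambda>\<omega>. (X k \<omega>)\<^sup>2) = 1" for k
    using standard_normal_moments[OF normal] standard_normal_moments(2)[OF normal, where k=1]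
      standard_normal_distributed_expectation[OF normal] by auto
  note moments = this
  have "a = sqrt (\<Sum>k\<in>UNIV. (c k)\<^sup>2)"
    using frobenius_norm_sq[of A] a by (simp add: a_def c_def case_prod_unfold real_sqrt_unique)
  then have intL: "integrable M L" and absL: "expectation (\<lambda>\<omega>. \<bar>L \<omega>\<bar>) \<le> a"
    using expectation_abs_sum_indep_centred_le[OF finite indepL]
    by (simp_all add: L_def power_mult_distrib moments)

  have "expectation (\<lambda>\<omega>. \<bar>W \<omega> + 2 * L \<omega>\<bar>) \<le> expectation (\<lambda>\<omega>. \<bar>W \<omega>\<bar> + 2 * \<bar>L \<omega>\<bar>)"
    using intW intL by (intro integral_mono) auto
  also have "\<dots> = expectation (\<lambda>\<omega>. \<bar>W \<omega>\<bar>) + 2 * expectation (\<lambda>\<omega>. \<bar>L \<omega>\<bar>)"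
    using intW intL by simp
  finally have bound: "expectation (\<lambda>\<omega>. \<bar>U1 (Y \<omega>) - a\<^sup>2\<bar>) \<le> sqrt (2 * N) + 2 * a"
    unfolding U using absW absL by simp
  have int: "integrable M (\<lambda>\<omega>. \<bar>U1 (Y \<omega>) - a\<^sup>2\<bar>)"
    unfolding U using intW intL by simp
  have "U1 (Y \<omega>) = a\<^sup>2 + (W \<omega> + 2 * L \<omega>)" for \<omega>
    using U[of \<omega>] by simp
  then have meas: "random_variable borel (\<lambda>\<omega>. U1 (Y \<omega>))"
    using intW intL by simp

  have N: "1 \<le> N"
    unfolding N_def by (metis One_nat_def Suc_leI nat_mult_1 of_nat_1 of_nat_le_iff of_nat_mult
        mult_le_mono zero_less_card_finite)
  then have r: "1 \<le> r" by (simp add: r_def ge_one_powr_ge_zero)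
  have "r\<^sup>2 = sqrt N"
    using N by (simp add: r_def powr_half_sqrt powr_powr flip: powr_numeral)
  moreover have "sqrt (2 * N) \<le> sqrt (4 * N)" using N by simp
  ultimately have "expectation (\<lambda>\<omega>. \<bar>U1 (Y \<omega>) - a\<^sup>2\<bar>) \<le> 2 * r\<^sup>2 + 2 * a"
    using bound by (simp add: real_sqrt_mult)
  from expectation_abs_sqrt_positive_part_diff_le[OF meas int this a r] int bound
  show ?thesis
    by (simp add: a_def N_def r_def mult.assoc)
qed

end
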